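(* Let $\alpha > -1$ be a real number and let $M = (C^{(\alpha)},3) \in \mathcal{B}(\ell^2)$ be the generalized Cesàro matrix of order three, i.e. the operator on $\ell^2$ given by the lower triangular infinite matrix $[m_{ij}]_{i,j \geq 0}$ with \[ m_{ij} = \begin{cases} \dfrac{3(i+1-j)(i+2-j)}{(i+1+\alpha)(i+2+\alpha)(i+3+\alpha)} & \text{for } 0 \leq j \leq i, \\ 0 & \text{for } j > i. \end{cases} \] Then $M$ is supraposinormal.
   Context: $\ell^2$ is the Hilbert space of square-summable sequences indexed by $n = 0,1,2,\dots$, and infinite matrices act on it with respect to the standard orthonormal basis, so $(Mf)_i = \sum_{j} m_{ij} f_j$. For a Hilbert space $H$, $\mathcal{B}(H)$ denotes the set of bounded linear operators on $H$. The matrix $M$ defines a bounded operator on $\ell^2$ for all $\alpha > -1$. An operator $A \in \mathcal{B}(H)$ is supraposinormal if there exist positive (i.e. positive semidefinite) operators $P, Q \in \mathcal{B}(H)$ such that $AQA^* = A^*PA$, where at least one of $P$, $Q$ has dense range. *)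

theory Defs
  imports "HOL-Analysis.Analysis"
begin

section \<open>Complex Hilbert spaces and bounded operators\<close>

text \<open>The inner product is linear in its first argument. Positive definiteness is part of
  \<open>cinner_norm\<close>, since \<open>norm\<close> is a norm.\<close>

class complex_inner = real_normed_vector +
  fixes scaleC :: "complex \<Rightarrow> 'a \<Rightarrow> 'a" (infixr "*\<^sub>C" 75)
    and cinner :: "'a \<Rightarrow> 'a \<Rightarrow> complex"
  assumes scaleC_add_right: "c *\<^sub>C (x + y) = c *\<^sub>C x + c *\<^sub>C y"
    and scaleC_add_left: "(c + d) *\<^sub>C x = c *\<^sub>C x + d *\<^sub>C x"
    and scaleC_scaleC: "c *\<^sub>C (d *\<^sub>C x) = (c * d) *\<^sub>C x"
    and scaleC_of_real: "complex_of_real r *\<^sub>C x = r *\<^sub>R x"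
    and cinner_commute: "cinner x y = cnj (cinner y x)"
    and cinner_add_left: "cinner (x + y) z = cinner x z + cinner y z"
    and cinner_scaleC_left: "cinner (c *\<^sub>C x) y = c * cinner x y"
    and cinner_norm: "cinner x x = complex_of_real ((norm x)\<^sup>2)"

class chilbert_space = complex_inner + complete_space

definition bounded_operator :: "('a::complex_inner \<Rightarrow> 'a) \<Rightarrow> bool" where
  "bounded_operator A \<longleftrightarrow> bounded_linear A \<and> (\<forall>c x. A (c *\<^sub>C x) = c *\<^sub>C A x)"

text \<open>On a Hilbert space, the adjoint of a bounded operator exists by the Riesz representation
  theorem; uniqueness is \<open>cadjoint_eqI\<close> below.\<close>

definition cadjoint :: "('a::complex_inner \<Rightarrow> 'a) \<Rightarrow> 'a \<Rightarrow> 'a" where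
  "cadjoint A = (THE B. \<forall>x y. cinner (A x) y = cinner x (B y))"

text \<open>Over the complex numbers, self-adjointness follows from the quadratic form being real.\<close>

definition positive_operator :: "('a::complex_inner \<Rightarrow> 'a) \<Rightarrow> bool" where
  "positive_operator P \<longleftrightarrow> bounded_operator P \<and>
     (\<forall>x. Im (cinner (P x) x) = 0 \<and> 0 \<le> Re (cinner (P x) x))"

definition dense_range :: "('a::complex_inner \<Rightarrow> 'a) \<Rightarrow> bool" where
  "dense_range A \<longleftrightarrow> closure (range A) = UNIV"

definition supraposinormal :: "('a::chilbert_space \<Rightarrow> 'a) \<Rightarrow> bool" where
  "supraposinormal A \<longleftrightarrow> bounded_operator A \<and>
     (\<exists>P Q. positive_operator P \<and> positive_operator Q \<and>
        A \<circ> Q \<circ> cadjoint A = cadjoint A \<circ> P \<circ> A \<and>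
        (dense_range P \<or> dense_range Q))"

lemma cinner_zero_right: "cinner x (0::'a::complex_inner) = 0"
  by (metis add_cancel_right_right cinner_add_left cinner_commute complex_cnj_zero_iff)

lemma cinner_diff_right:
  "cinner x (y - z) = cinner x y - cinner x (z::'a::complex_inner)"
proof -
  have "cinner x (y - z + z) = cinner x (y - z) + cinner x z"
    by (metis cinner_add_left cinner_commute complex_cnj_add)
  then show ?thesis by simp
qed

lemma cadjoint_eqI:
  fixes A :: "'a::complex_inner \<Rightarrow> 'a"
  assumes "\<And>x y. cinner (A x) y = cinner x (B y)"
  shows "cadjoint A = B"
  unfolding cadjoint_def
proof (rule the_equality)
  show "\<forall>x y. cinner (A x) y = cinner x (B y)" using assms by simp
  fix C assume C: "\<forall>x y. cinner (A x) y = cinner x (C y)"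
  show "C = B"
  proof
    fix y
    have "cinner (C y - B y) (C y - B y) = 0"
      using C assms by (metis cinner_diff_right diff_self)
    then show "C y = B y" by (simp add: cinner_norm)
  qed
qed


section \<open>The Hilbert space of square-summable sequences\<close>

typedef ell2 = "{f :: nat \<Rightarrow> complex. summable (\<lambda>n. (cmod (f n))\<^sup>2)}"
  morphisms ell2_nth Abs_ell2
  by (rule exI[of _ "\<lambda>_. 0"]) simp

lemma ell2_eqI: "(\<And>n. ell2_nth f n = ell2_nth g n) \<Longrightarrow> f = g"
  by (metis ell2_nth_inject ext)

lemma summable_ell2: "summable (\<lambda>n. (cmod (ell2_nth f n))\<^sup>2)"
  using ell2_nth by auto

lemma ell2_nth_Abs:
  "summable (\<lambda>n. (cmod (f n))\<^sup>2) \<Longrightarrow> ell2_nth (Abs_ell2 f) = f"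
  by (simp add: Abs_ell2_inverse)

lemma L2_set_power2: "(L2_set f A)\<^sup>2 = (\<Sum>i\<in>A. (f i)\<^sup>2)"
  by (simp add: L2_set_def sum_nonneg)

lemma L2_bound_summable:
  assumes "\<And>N. L2_set (\<lambda>n. cmod (f n)) {..<N} \<le> B"
  shows "summable (\<lambda>n. (cmod (f n))\<^sup>2)" "sqrt (\<Sum>n. (cmod (f n))\<^sup>2) \<le> B"
proof -
  have B: "0 \<le> B" using assms[of 0] by simp
  have *: "(\<Sum>n<N. (cmod (f n))\<^sup>2) \<le> B\<^sup>2" for N
    using power_mono[OF assms[of N], of 2] by (simp add: L2_set_power2)
  show s: "summable (\<lambda>n. (cmod (f n))\<^sup>2)"
    by (rule bounded_imp_summable[where B = "B\<^sup>2"])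
       (use * [of "Suc _"] in \<open>auto simp: lessThan_Suc_atMost\<close>)
  have "(\<Sum>n. (cmod (f n))\<^sup>2) \<le> B\<^sup>2"
    by (rule suminf_le_const[OF s *])
  then show "sqrt (\<Sum>n. (cmod (f n))\<^sup>2) \<le> B"
    using B real_le_lsqrt by (simp add: real_le_lsqrt suminf_nonneg[OF s])
qed

lemma L2_set_le_suminf:
  assumes "summable (\<lambda>n. (cmod (f n))\<^sup>2)"
  shows "L2_set (\<lambda>n. cmod (f n)) {..<N} \<le> sqrt (\<Sum>n. (cmod (f n))\<^sup>2)"
  unfolding L2_set_def
  by (intro real_sqrt_le_mono sum_le_suminf[OF assms]) auto

lemma L2_set_add_le:
  "L2_set (\<lambda>n. cmod (f n + g n)) A \<le> L2_set (\<lambda>n. cmod (f n)) A + L2_set (\<lambda>n. cmod (g n)) A"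
  by (rule order_trans[OF L2_set_mono L2_set_triangle_ineq]) (auto intro: norm_triangle_ineq)

lemma L2_set_cmult:
  "L2_set (\<lambda>n. cmod (c * f n)) A = cmod c * L2_set (\<lambda>n. cmod (f n)) A"
  by (simp add: norm_mult L2_set_right_distrib)

lemma summable_add_ell2: "summable (\<lambda>n. (cmod (ell2_nth f n + ell2_nth g n))\<^sup>2)"
  by (rule L2_bound_summable(1), rule order_trans[OF L2_set_add_le], rule add_mono;
      rule L2_set_le_suminf[OF summable_ell2])

lemma summable_cmult_ell2: "summable (\<lambda>n. (cmod (c * ell2_nth f n))\<^sup>2)"
  by (simp add: norm_mult power_mult_distrib summable_mult summable_ell2)

instantiation ell2 :: real_normed_vector
begin

definition "0 = Abs_ell2 (\<lambda>_. 0)"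
definition "f + g = Abs_ell2 (\<lambda>n. ell2_nth f n + ell2_nth g n)"
definition "- f = Abs_ell2 (\<lambda>n. - ell2_nth f n)"
definition "f - g = f + (- g)" for f g :: ell2
definition "r *\<^sub>R f = Abs_ell2 (\<lambda>n. complex_of_real r * ell2_nth f n)"
definition "norm f = sqrt (\<Sum>n. (cmod (ell2_nth f n))\<^sup>2)"
definition "sgn f = inverse (norm f) *\<^sub>R f" for f :: ell2
definition "dist f g = norm (f - g)" for f g :: ell2
definition [code del]:
  "(uniformity :: (ell2 \<times> ell2) filter) = (INF e\<in>{0 <..}. principal {(x, y). dist x y < e})"
definition [code del]:
  "open (U :: ell2 set) \<longleftrightarrow> (\<forall>x\<in>U. eventually (\<lambda>(x', y). x' = x \<longrightarrow> y \<in> U) uniformity)"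

lemma zero_ell2_nth: "ell2_nth 0 n = 0"
  by (simp add: zero_ell2_def ell2_nth_Abs)

lemma add_ell2_nth: "ell2_nth (f + g) n = ell2_nth f n + ell2_nth g n"
  by (simp add: plus_ell2_def ell2_nth_Abs summable_add_ell2)

lemma uminus_ell2_nth: "ell2_nth (- f) n = - ell2_nth f n"
  by (simp add: uminus_ell2_def ell2_nth_Abs summable_ell2)

lemma minus_ell2_nth: "ell2_nth (f - g) n = ell2_nth f n - ell2_nth g n"
  by (simp add: minus_ell2_def add_ell2_nth uminus_ell2_nth)

lemma scaleR_ell2_nth: "ell2_nth (r *\<^sub>R f) n = complex_of_real r * ell2_nth f n"
  by (simp add: scaleR_ell2_def ell2_nth_Abs summable_cmult_ell2)

lemmas ell2_nth_simps =
  zero_ell2_nth add_ell2_nth uminus_ell2_nth minus_ell2_nth scaleR_ell2_nth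

lemma L2_set_le_norm_ell2: "L2_set (\<lambda>n. cmod (ell2_nth f n)) {..<N} \<le> norm f"
  unfolding norm_ell2_def by (rule L2_set_le_suminf[OF summable_ell2])

lemma norm_ell2_leI:
  "(\<And>N. L2_set (\<lambda>n. cmod (ell2_nth f n)) {..<N} \<le> B) \<Longrightarrow> norm f \<le> B"
  unfolding norm_ell2_def by (rule L2_bound_summable(2))

lemma norm_nth_le_ell2: "cmod (ell2_nth f n) \<le> norm f"
  by (rule order_trans[OF member_le_L2_set L2_set_le_norm_ell2[where N = "Suc n"]]) auto

instance
proof
  fix f g h :: ell2 and a b :: real
  show "f + g + h = f + (g + h)" by (rule ell2_eqI) (simp add: ell2_nth_simps)
  show "f + g = g + f" by (rule ell2_eqI) (simp add: ell2_nth_simps)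
  show "0 + f = f" by (rule ell2_eqI) (simp add: ell2_nth_simps)
  show "- f + f = 0" by (rule ell2_eqI) (simp add: ell2_nth_simps)
  show "f - g = f + - g" by (rule minus_ell2_def)
  show "a *\<^sub>R (f + g) = a *\<^sub>R f + a *\<^sub>R g"
    by (rule ell2_eqI) (simp add: ell2_nth_simps algebra_simps)
  show "(a + b) *\<^sub>R f = a *\<^sub>R f + b *\<^sub>R f"
    by (rule ell2_eqI) (simp add: ell2_nth_simps algebra_simps)
  show "a *\<^sub>R b *\<^sub>R f = (a * b) *\<^sub>R f" by (rule ell2_eqI) (simp add: ell2_nth_simps)
  show "1 *\<^sub>R f = f" by (rule ell2_eqI) (simp add: ell2_nth_simps)
  show "sgn f = inverse (norm f) *\<^sub>R f" by (rule sgn_ell2_def)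
  show "dist f g = norm (f - g)" by (rule dist_ell2_def)
  show "(uniformity :: (ell2 \<times> ell2) filter)
      = (INF e\<in>{0 <..}. principal {(x, y). dist x y < e})"
    by (rule uniformity_ell2_def)
  show "open U \<longleftrightarrow> (\<forall>x\<in>U. \<forall>\<^sub>F (x', y) in uniformity. x' = x \<longrightarrow> y \<in> U)"
    for U :: "ell2 set"
    by (rule open_ell2_def)
  show "norm f = 0 \<longleftrightarrow> f = 0"
  proof
    assume "norm f = 0"
    then have "ell2_nth f n = 0" for n using norm_nth_le_ell2[of f n] by simp
    then show "f = 0" by (intro ell2_eqI) (simp add: ell2_nth_simps)
  qed (simp add: norm_ell2_def ell2_nth_simps)
  show "norm (f + g) \<le> norm f + norm g"
    by (rule norm_ell2_leI, unfold add_ell2_nth, rule order_trans[OF L2_set_add_le],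
        intro add_mono L2_set_le_norm_ell2)
  show "norm (a *\<^sub>R f) = \<bar>a\<bar> * norm f"
    by (simp add: norm_ell2_def scaleR_ell2_nth norm_mult power_mult_distrib
        suminf_mult[OF summable_ell2] real_sqrt_mult)
qed

end

lemma summable_cinner_ell2: "summable (\<lambda>n. ell2_nth f n * cnj (ell2_nth g n))"
proof (rule summable_comparison_test')
  show "summable (\<lambda>n. (cmod (ell2_nth f n))\<^sup>2 + (cmod (ell2_nth g n))\<^sup>2)"
    by (intro summable_add summable_ell2)
  show "norm (ell2_nth f n * cnj (ell2_nth g n))
      \<le> (cmod (ell2_nth f n))\<^sup>2 + (cmod (ell2_nth g n))\<^sup>2" for n
  proof -
    have "2 * (cmod (ell2_nth f n) * cmod (ell2_nth g n))
        \<le> (cmod (ell2_nth f n))\<^sup>2 + (cmod (ell2_nth g n))\<^sup>2"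
      using sum_squares_bound[of "cmod (ell2_nth f n)" "cmod (ell2_nth g n)"]
      by (simp add: mult.assoc)
    moreover have "0 \<le> cmod (ell2_nth f n) * cmod (ell2_nth g n)" by simp
    ultimately have "cmod (ell2_nth f n) * cmod (ell2_nth g n)
        \<le> (cmod (ell2_nth f n))\<^sup>2 + (cmod (ell2_nth g n))\<^sup>2" by linarith
    then show ?thesis by (simp add: norm_mult)
  qed
qed

instantiation ell2 :: complex_inner
begin

definition "c *\<^sub>C f = Abs_ell2 (\<lambda>n. c * ell2_nth f n)"
definition "cinner f g = (\<Sum>n. ell2_nth f n * cnj (ell2_nth g n))"

lemma scaleC_ell2_nth: "ell2_nth (c *\<^sub>C f) n = c * ell2_nth f n"
  by (simp add: scaleC_ell2_def ell2_nth_Abs summable_cmult_ell2)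

instance
proof
  fix f g h :: ell2 and c d :: complex and r :: real
  show "c *\<^sub>C (f + g) = c *\<^sub>C f + c *\<^sub>C g"
    by (rule ell2_eqI) (simp add: ell2_nth_simps scaleC_ell2_nth algebra_simps)
  show "(c + d) *\<^sub>C f = c *\<^sub>C f + d *\<^sub>C f"
    by (rule ell2_eqI) (simp add: ell2_nth_simps scaleC_ell2_nth algebra_simps)
  show "c *\<^sub>C d *\<^sub>C f = (c * d) *\<^sub>C f"
    by (rule ell2_eqI) (simp add: scaleC_ell2_nth)
  show "complex_of_real r *\<^sub>C f = r *\<^sub>R f"
    by (rule ell2_eqI) (simp add: ell2_nth_simps scaleC_ell2_nth)
  show "cinner f g = cnj (cinner g f)"
    unfolding cinner_ell2_def
    using bounded_linear.suminf[OF bounded_linear_cnj summable_cinner_ell2[of g f]]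
    by (simp add: mult.commute)
  show "cinner (f + g) h = cinner f h + cinner g h"
    unfolding cinner_ell2_def ell2_nth_simps distrib_right
    by (rule suminf_add[symmetric]; rule summable_cinner_ell2)
  show "cinner (c *\<^sub>C f) g = c * cinner f g"
    unfolding cinner_ell2_def scaleC_ell2_nth mult.assoc
    by (rule suminf_mult[OF summable_cinner_ell2])
  have "cinner f f = (\<Sum>n. complex_of_real ((cmod (ell2_nth f n))\<^sup>2))"
    unfolding cinner_ell2_def by (simp only: complex_norm_square)
  also have "\<dots> = complex_of_real (\<Sum>n. (cmod (ell2_nth f n))\<^sup>2)"
    by (rule suminf_of_real[OF summable_ell2, symmetric])
  also have "\<dots> = complex_of_real ((norm f)\<^sup>2)"
    by (simp add: norm_ell2_def suminf_nonneg[OF summable_ell2])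
  finally show "cinner f f = complex_of_real ((norm f)\<^sup>2)" .
qed

end

instance ell2 :: chilbert_space
proof
  fix X :: "nat \<Rightarrow> ell2"
  assume X: "Cauchy X"
  have "Cauchy (\<lambda>k. ell2_nth (X k) n)" for n
  proof (rule CauchyI)
    fix e :: real assume "0 < e"
    then obtain K where "\<forall>k\<ge>K. \<forall>l\<ge>K. norm (X k - X l) < e" using CauchyD[OF X] by blast
    then show "\<exists>K. \<forall>k\<ge>K. \<forall>l\<ge>K. norm (ell2_nth (X k) n - ell2_nth (X l) n) < e"
      using norm_nth_le_ell2[of "X _ - X _" n] by (metis minus_ell2_nth order_le_less_trans)
  qed
  then have "\<exists>z. (\<lambda>k. ell2_nth (X k) n) \<longlonglongrightarrow> z" for n
    using Cauchy_convergent convergent_def by blast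
  then obtain g where g: "\<And>n. (\<lambda>k. ell2_nth (X k) n) \<longlonglongrightarrow> g n" by metis
  have tail: "\<exists>K. \<forall>k\<ge>K. \<forall>N. L2_set (\<lambda>n. cmod (ell2_nth (X k) n - g n)) {..<N} \<le> e"
    if e: "0 < e" for e
  proof -
    obtain K where K: "\<forall>k\<ge>K. \<forall>l\<ge>K. norm (X k - X l) < e" using CauchyD[OF X e] by blast
    have "L2_set (\<lambda>n. cmod (ell2_nth (X k) n - g n)) {..<N} \<le> e" if k: "k \<ge> K" for k N
    proof (rule LIMSEQ_le_const2)
      show "(\<lambda>l. L2_set (\<lambda>n. cmod (ell2_nth (X k) n - ell2_nth (X l) n)) {..<N})
          \<longlonglongrightarrow> L2_set (\<lambda>n. cmod (ell2_nth (X k) n - g n)) {..<N}"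
        unfolding L2_set_def by (intro tendsto_intros g)
      have "L2_set (\<lambda>n. cmod (ell2_nth (X k) n - ell2_nth (X l) n)) {..<N} \<le> e"
        if "l \<ge> K" for l
      proof -
        have "norm (X k - X l) < e" using K k that by blast
        then show ?thesis
          using L2_set_le_norm_ell2[of "X k - X l" N] by (simp add: minus_ell2_nth)
      qed
      then show "\<exists>M. \<forall>l\<ge>M. L2_set (\<lambda>n. cmod (ell2_nth (X k) n - ell2_nth (X l) n)) {..<N} \<le> e"
        by blast
    qed
    then show ?thesis by blast
  qed
  obtain K where K: "\<And>N. L2_set (\<lambda>n. cmod (ell2_nth (X K) n - g n)) {..<N} \<le> 1"
    using tail[of 1] by auto
  have "summable (\<lambda>n. (cmod (g n))\<^sup>2)"
  proof (rule L2_bound_summable(1))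
    fix N
    have "L2_set (\<lambda>n. cmod (g n)) {..<N}
        = L2_set (\<lambda>n. cmod (ell2_nth (X K) n + - 1 * (ell2_nth (X K) n - g n))) {..<N}"
      by simp
    also have "\<dots> \<le> L2_set (\<lambda>n. cmod (ell2_nth (X K) n)) {..<N}
        + L2_set (\<lambda>n. cmod (- 1 * (ell2_nth (X K) n - g n))) {..<N}"
      by (rule L2_set_add_le)
    also have "\<dots> \<le> norm (X K) + 1"
      unfolding L2_set_cmult using L2_set_le_norm_ell2 K by (simp add: add_mono)
    finally show "L2_set (\<lambda>n. cmod (g n)) {..<N} \<le> norm (X K) + 1" .
  qed
  then have G: "ell2_nth (Abs_ell2 g) = g" by (rule ell2_nth_Abs)
  have "X \<longlonglongrightarrow> Abs_ell2 g"
  proof (rule LIMSEQ_I)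
    fix e :: real assume e: "0 < e"
    obtain L where L: "\<forall>k\<ge>L. \<forall>N. L2_set (\<lambda>n. cmod (ell2_nth (X k) n - g n)) {..<N} \<le> e / 2"
      using tail[of "e / 2"] e by auto
    have "norm (X k - Abs_ell2 g) \<le> e / 2" if "k \<ge> L" for k
      by (rule norm_ell2_leI) (use L that in \<open>simp add: minus_ell2_nth G\<close>)
    then show "\<exists>L. \<forall>k\<ge>L. norm (X k - Abs_ell2 g) < e"
      using e by (intro exI[of _ L]) force
  qed
  then show "convergent X" by (auto simp: convergent_def)
qed


section \<open>Matrix operators and the generalized Cesaro matrix of order three\<close>

definition has_matrix :: "(ell2 \<Rightarrow> ell2) \<Rightarrow> (nat \<Rightarrow> nat \<Rightarrow> complex) \<Rightarrow> bool" where
  "has_matrix A m \<longleftrightarrow> (\<forall>f i. (\<lambda>j. m i j * ell2_nth f j) sums ell2_nth (A f) i)"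

definition cesaro3 :: "real \<Rightarrow> nat \<Rightarrow> nat \<Rightarrow> complex" where
  "cesaro3 \<alpha> i j =
    (if j \<le> i
     then complex_of_real
       (3 * (real i + 1 - real j) * (real i + 2 - real j) /
         ((real i + 1 + \<alpha>) * (real i + 2 + \<alpha>) * (real i + 3 + \<alpha>)))
     else 0)"

text \<open>A matrix determines at most one operator on \<open>ell2\<close>, and for \<open>\<alpha> > -1\<close> the matrix
  \<open>cesaro3 \<alpha>\<close> does define a bounded one; the bound comes from Hardy's inequality.\<close>

lemma has_matrix_unique: "has_matrix A m \<Longrightarrow> has_matrix B m \<Longrightarrow> A = B"
  unfolding has_matrix_def by (intro ext ell2_eqI) (meson sums_unique2)

lemma hardy_telescope:
  fixes a :: "nat \<Rightarrow> real"
  defines "A \<equiv> \<lambda>n. (\<Sum>j\<le>n. a j) / (real n + 1)"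
  shows "(\<Sum>n<Suc N. (A n)\<^sup>2) + (real N + 1) * (A N)\<^sup>2 \<le> 2 * (\<Sum>n<Suc N. a n * A n)"
proof (induction N)
  case 0
  show ?case by (simp add: A_def power2_eq_square)
next
  case (Suc N)
  define x y where "x = A N" and "y = A (Suc N)"
  have "a (Suc N) = (real N + 2) * y - (real N + 1) * x"
  proof -
    have "(real N + 2) * y = (\<Sum>j\<le>Suc N. a j)" "(real N + 1) * x = (\<Sum>j\<le>N. a j)"
      by (simp_all add: x_def y_def A_def divide_simps del: sum.atMost_Suc)
    then show ?thesis by simp
  qed
  then have "2 * (a (Suc N) * y) - y\<^sup>2 - (real N + 2) * y\<^sup>2 + (real N + 1) * x\<^sup>2
      = (real N + 1) * (x - y)\<^sup>2"
    unfolding power2_eq_square by algebra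
  also have "\<dots> \<ge> 0" by simp
  finally have "y\<^sup>2 + (real N + 2) * y\<^sup>2 \<le> 2 * (a (Suc N) * y) + (real N + 1) * x\<^sup>2" by linarith
  with Suc show ?case
    unfolding sum.lessThan_Suc[of _ "Suc N"] x_def y_def distrib_left of_nat_Suc
    by (simp add: algebra_simps)
qed

lemma hardy_L2_set:
  fixes a :: "nat \<Rightarrow> real"
  assumes "\<And>n. 0 \<le> a n"
  shows "L2_set (\<lambda>n. (\<Sum>j\<le>n. a j) / (real n + 1)) {..<N} \<le> 2 * L2_set a {..<N}"
proof (cases N)
  case (Suc k)
  define A where "A = (\<lambda>n. (\<Sum>j\<le>n. a j) / (real n + 1))"
  have A: "0 \<le> A n" for n unfolding A_def using assms by (simp add: sum_nonneg)
  have "(\<Sum>n<N. (A n)\<^sup>2) \<le> 2 * (\<Sum>n<N. a n * A n)"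
    using hardy_telescope[of a k] unfolding Suc A_def
    by (smt (verit) zero_le_mult_iff of_nat_0_le_iff zero_le_power2)
  also have "(\<Sum>n<N. a n * A n) \<le> L2_set a {..<N} * L2_set A {..<N}"
    using L2_set_mult_ineq[of a A "{..<N}"] assms A by simp
  finally have "L2_set A {..<N} * L2_set A {..<N} \<le> (2 * L2_set a {..<N}) * L2_set A {..<N}"
    using L2_set_power2[of A "{..<N}"] by (simp add: power2_eq_square mult.assoc)
  then have "L2_set A {..<N} \<le> 2 * L2_set a {..<N}"
    using L2_set_nonneg[of A "{..<N}"] L2_set_nonneg[of a "{..<N}"]
    by (cases "L2_set A {..<N} = 0") (auto simp: mult_le_cancel_right)
  then show ?thesis by (simp add: A_def)
qed simp

lemma cmod_cesaro3_le:
  assumes "\<alpha> > -1" "j \<le> i"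
  shows "cmod (cesaro3 \<alpha> i j) \<le> 3 / min 1 (1 + \<alpha>) / (real i + 1)"
proof -
  define c where "c = min 1 (1 + \<alpha>)"
  have c: "0 < c" using assms by (simp add: c_def)
  have 1: "c * (real i + 1) \<le> real i + 1 + \<alpha>"
  proof -
    have "c * real i \<le> 1 * real i" by (rule mult_right_mono) (auto simp: c_def)
    moreover have "c \<le> 1 + \<alpha>" by (simp add: c_def)
    ultimately show ?thesis by (simp add: algebra_simps)
  qed
  have "(c * (real i + 1)) * (real i + 1) * (real i + 2)
      \<le> (real i + 1 + \<alpha>) * (real i + 2 + \<alpha>) * (real i + 3 + \<alpha>)"
    by (intro mult_mono 1) (use assms c 1 in auto)
  moreover have "3 * (real i + 1 - real j) * (real i + 2 - real j)
      \<le> 3 * (real i + 1) * (real i + 2)"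
    by (intro mult_mono) (use assms in auto)
  ultimately have "3 * (real i + 1 - real j) * (real i + 2 - real j) /
         ((real i + 1 + \<alpha>) * (real i + 2 + \<alpha>) * (real i + 3 + \<alpha>))
      \<le> 3 * (real i + 1) * (real i + 2) / ((c * (real i + 1)) * (real i + 1) * (real i + 2))"
    by (intro frac_le) (use c in auto)
  also have "\<dots> = 3 / c / (real i + 1)"
    using c by (simp add: divide_simps)
  moreover have "0 \<le> 3 * (real i + 1 - real j) * (real i + 2 - real j) /
         ((real i + 1 + \<alpha>) * (real i + 2 + \<alpha>) * (real i + 3 + \<alpha>))"
    by (intro divide_nonneg_nonneg mult_nonneg_nonneg) (use assms in auto)
  ultimately show ?thesis using assms(2)
    unfolding cesaro3_def c_def by (simp only: if_True norm_of_real abs_of_nonneg)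
qed

lemma cesaro3_bounded_operator_exists:
  assumes "\<alpha> > -1"
  shows "\<exists>M. bounded_operator M \<and> has_matrix M (cesaro3 \<alpha>)"
proof -
  define K where "K = 3 / min 1 (1 + \<alpha>)"
  have K: "0 < K" using assms by (simp add: K_def)
  define T where "T = (\<lambda>f i. \<Sum>j\<le>i. cesaro3 \<alpha> i j * ell2_nth f j)"
  have Tle: "cmod (T f i) \<le> K * ((\<Sum>j\<le>i. cmod (ell2_nth f j)) / (real i + 1))" for f i
  proof -
    have "cmod (T f i) \<le> (\<Sum>j\<le>i. K / (real i + 1) * cmod (ell2_nth f j))"
      unfolding T_def
    proof (rule sum_norm_le)
      fix j assume "j \<in> {..i}"
      then have "cmod (cesaro3 \<alpha> i j) \<le> K / (real i + 1)"
        unfolding K_def by (intro cmod_cesaro3_le assms) simp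
      then show "norm (cesaro3 \<alpha> i j * ell2_nth f j) \<le> K / (real i + 1) * cmod (ell2_nth f j)"
        unfolding norm_mult by (rule mult_right_mono) simp
    qed
    then show ?thesis by (simp add: sum_distrib_left sum_divide_distrib)
  qed
  have L2: "L2_set (\<lambda>i. cmod (T f i)) {..<N} \<le> 2 * K * norm f" for f N
  proof -
    have "L2_set (\<lambda>i. cmod (T f i)) {..<N}
        \<le> L2_set (\<lambda>i. K * ((\<Sum>j\<le>i. cmod (ell2_nth f j)) / (real i + 1))) {..<N}"
      by (rule L2_set_mono) (use Tle in simp_all)
    also have "\<dots> = K * L2_set (\<lambda>i. (\<Sum>j\<le>i. cmod (ell2_nth f j)) / (real i + 1)) {..<N}"
      using K by (intro L2_set_right_distrib[symmetric]) simp
    also have "\<dots> \<le> K * (2 * norm f)"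
      using K hardy_L2_set[of "\<lambda>j. cmod (ell2_nth f j)" N] L2_set_le_norm_ell2[of f N]
      by (intro mult_left_mono) auto
    finally show ?thesis by simp
  qed
  define M where "M = (\<lambda>f. Abs_ell2 (T f))"
  have M: "ell2_nth (M f) i = T f i" for f i
    unfolding M_def by (simp add: ell2_nth_Abs[OF L2_bound_summable(1)[OF L2]])
  have "bounded_linear M"
  proof (rule bounded_linear_intro[where K = "2 * K"])
    show "M (f + g) = M f + M g" for f g
      by (rule ell2_eqI)
         (simp add: M T_def ell2_nth_simps distrib_left sum.distrib)
    show "M (r *\<^sub>R f) = r *\<^sub>R M f" for r f
      by (rule ell2_eqI) (simp add: M T_def ell2_nth_simps sum_distrib_left mult_ac)
    show "norm (M f) \<le> norm f * (2 * K)" for f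
      by (rule norm_ell2_leI) (use L2 in \<open>simp add: M mult_ac\<close>)
  qed
  moreover have "M (c *\<^sub>C f) = c *\<^sub>C M f" for c f
    by (rule ell2_eqI) (simp add: M T_def scaleC_ell2_nth sum_distrib_left mult_ac)
  moreover have "has_matrix M (cesaro3 \<alpha>)"
    unfolding has_matrix_def M T_def
    by (intro allI sums_finite) (auto simp: cesaro3_def)
  ultimately show ?thesis by (auto simp: bounded_operator_def)
qed

end

theory Submission
  imports Defs
begin

text \<open>The operator \<open>M\<close> is even posinormal: \<open>M M\<^sup>* = M\<^sup>* P M\<close> for some \<open>P \<ge> 0\<close>, so \<open>Q = I\<close> works. It is
  enough to factor \<open>M = M\<^sup>* S\<close> with \<open>S\<close> bounded, and then \<open>P = S S\<^sup>*\<close>. Up to a diagonal factor \<open>M\<close>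
  is \<open>(1 - U)\<^sup>-\<^sup>3\<close> for the unilateral shift \<open>U\<close>, so every unit vector has a preimage \<open>g j\<close> under \<open>M\<close>
  supported on \<open>{j..j+3}\<close>, and \<open>S\<close> must be \<open>(S x)\<^sub>j = \<langle>M x, g j\<rangle>\<close>, a weighted third difference of
  \<open>M x\<close>. Its matrix entries on and below the diagonal are \<open>O(1/(j+1))\<close>, hence bounded by Hardy's
  inequality, and the three superdiagonals are bounded. The factorization then only has to be tested
  against the \<open>g j\<close>, which are total because a null sequence with vanishing third differences is zero.\<close>

section \<open>Adjoints on the sequence space\<close>

lemma cinner_add_right:
  "cinner x (y + z) = cinner x y + cinner x (z::'a::complex_inner)"
  by (metis cinner_add_left cinner_commute complex_cnj_add)

lemma cinner_diff_left:
  "cinner (x - y) z = cinner x z - cinner y (z::'a::complex_inner)"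
  by (metis cinner_diff_right cinner_commute complex_cnj_diff)

lemma cinner_scaleC_right:
  "cinner x (c *\<^sub>C y) = cnj c * cinner x (y::'a::complex_inner)"
  by (metis cinner_scaleC_left cinner_commute complex_cnj_mult)

lemma cinner_scaleR_right:
  "cinner x (r *\<^sub>R y) = complex_of_real r * cinner x (y::'a::complex_inner)"
  by (metis cinner_scaleC_right scaleC_of_real complex_cnj_complex_of_real)

lemma cinner_eqI:
  fixes u v :: "'a::complex_inner"
  assumes "\<And>y. cinner u y = cinner v y"
  shows "u = v"
proof -
  have "cinner (u - v) (u - v) = 0" by (simp add: cinner_diff_left assms)
  then show ?thesis by (simp add: cinner_norm)
qed

text \<open>Cauchy-Schwarz for finite sums bounds every partial sum of the series, and the bound
  survives the limit.\<close>

lemma cmod_cinner_ell2_le: "cmod (cinner f g) \<le> norm f * norm (g::ell2)"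
proof (rule LIMSEQ_le_const2)
  show "(\<lambda>N. cmod (\<Sum>n<N. ell2_nth f n * cnj (ell2_nth g n))) \<longlonglongrightarrow> cmod (cinner f g)"
    unfolding cinner_ell2_def by (intro tendsto_norm summable_LIMSEQ summable_cinner_ell2)
  have "cmod (\<Sum>n<N. ell2_nth f n * cnj (ell2_nth g n)) \<le> norm f * norm g" for N
  proof -
    have "cmod (\<Sum>n<N. ell2_nth f n * cnj (ell2_nth g n))
        \<le> (\<Sum>n<N. cmod (ell2_nth f n) * cmod (ell2_nth g n))"
      by (rule order_trans[OF norm_sum]) (simp add: norm_mult)
    also have "\<dots> \<le> L2_set (\<lambda>n. cmod (ell2_nth f n)) {..<N} * L2_set (\<lambda>n. cmod (ell2_nth g n)) {..<N}"
      using L2_set_mult_ineq[of "\<lambda>n. cmod (ell2_nth f n)" "\<lambda>n. cmod (ell2_nth g n)" "{..<N}"] by simp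
    also have "\<dots> \<le> norm f * norm g"
      by (intro mult_mono L2_set_le_norm_ell2) (auto simp: L2_set_nonneg)
    finally show ?thesis .
  qed
  then show "\<exists>N. \<forall>n\<ge>N. cmod (\<Sum>n<n. ell2_nth f n * cnj (ell2_nth g n)) \<le> norm f * norm g"
    by blast
qed

section \<open>Unit vectors and finite truncations\<close>

lemma ell2_nth_sum: "ell2_nth (\<Sum>i\<in>A. F i) n = (\<Sum>i\<in>A. ell2_nth (F i) n)"
  by (induction A rule: infinite_finite_induct) (simp_all add: ell2_nth_simps)

definition ell2_unit :: "nat \<Rightarrow> ell2" where
  "ell2_unit n = Abs_ell2 (\<lambda>k. if k = n then 1 else 0)"

lemma ell2_nth_unit: "ell2_nth (ell2_unit n) k = (if k = n then 1 else 0)"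
proof -
  have "summable (\<lambda>k. (cmod (if k = n then 1 else 0))\<^sup>2)"
    by (rule summable_finite[of "{n}"]) auto
  then show ?thesis unfolding ell2_unit_def by (simp add: ell2_nth_Abs)
qed

lemma cinner_unit_right: "cinner x (ell2_unit n) = ell2_nth x n"
proof -
  have "cinner x (ell2_unit n) = (\<Sum>k\<in>{n}. ell2_nth x k * cnj (ell2_nth (ell2_unit n) k))"
    unfolding cinner_ell2_def by (rule suminf_finite) (auto simp: ell2_nth_unit)
  then show ?thesis by (simp add: ell2_nth_unit)
qed

lemma has_matrix_column:
  assumes "has_matrix A m"
  shows "ell2_nth (A (ell2_unit j)) i = m i j"
proof -
  have "(\<lambda>k. m i k * ell2_nth (ell2_unit j) k) sums ell2_nth (A (ell2_unit j)) i"
    using assms by (simp add: has_matrix_def)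
  moreover have "(\<lambda>k. m i k * ell2_nth (ell2_unit j) k)
      sums (\<Sum>k\<in>{j}. m i k * ell2_nth (ell2_unit j) k)"
    by (rule sums_finite) (auto simp: ell2_nth_unit)
  ultimately show ?thesis by (auto simp: ell2_nth_unit dest: sums_unique2)
qed

definition ell2_trunc :: "nat \<Rightarrow> (nat \<Rightarrow> complex) \<Rightarrow> ell2" where
  "ell2_trunc N c = (\<Sum>n<N. c n *\<^sub>C ell2_unit n)"

lemma ell2_nth_trunc: "ell2_nth (ell2_trunc N c) k = (if k < N then c k else 0)"
  by (simp add: ell2_trunc_def ell2_nth_sum scaleC_ell2_nth ell2_nth_unit if_distrib cong: if_cong)

lemma norm_ell2_trunc: "norm (ell2_trunc N c) = L2_set (\<lambda>n. cmod (c n)) {..<N}"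
proof -
  have "(\<Sum>n. (cmod (ell2_nth (ell2_trunc N c) n))\<^sup>2)
      = (\<Sum>n<N. (cmod (ell2_nth (ell2_trunc N c) n))\<^sup>2)"
    by (rule suminf_finite) (auto simp: ell2_nth_trunc)
  then show ?thesis by (simp add: norm_ell2_def L2_set_def ell2_nth_trunc)
qed

text \<open>The squared error is the tail of a convergent series, that is, the full sum minus a
  partial sum.\<close>

lemma ell2_trunc_tendsto: "(\<lambda>N. ell2_trunc N (ell2_nth x)) \<longlonglongrightarrow> x"
proof -
  have eq: "(norm (ell2_trunc N (ell2_nth x) - x))
      = sqrt ((\<Sum>n. (cmod (ell2_nth x n))\<^sup>2) - (\<Sum>n<N. (cmod (ell2_nth x n))\<^sup>2))" for N
  proof -
    have "(\<lambda>n. (cmod (ell2_nth x n))\<^sup>2 - (if n \<in> {..<N} then (cmod (ell2_nth x n))\<^sup>2 else 0))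
        sums ((\<Sum>n. (cmod (ell2_nth x n))\<^sup>2) - (\<Sum>n<N. (cmod (ell2_nth x n))\<^sup>2))"
      by (intro sums_diff summable_sums[OF summable_ell2] sums_If_finite_set) simp
    also have "(\<lambda>n. (cmod (ell2_nth x n))\<^sup>2 - (if n \<in> {..<N} then (cmod (ell2_nth x n))\<^sup>2 else 0))
        = (\<lambda>n. (cmod (ell2_nth (ell2_trunc N (ell2_nth x) - x) n))\<^sup>2)"
      by (auto simp: minus_ell2_nth ell2_nth_trunc)
    finally show ?thesis by (simp add: norm_ell2_def sums_iff)
  qed
  have "(\<lambda>N. sqrt ((\<Sum>n. (cmod (ell2_nth x n))\<^sup>2) - (\<Sum>n<N. (cmod (ell2_nth x n))\<^sup>2)))
      \<longlonglongrightarrow> sqrt ((\<Sum>n. (cmod (ell2_nth x n))\<^sup>2) - (\<Sum>n. (cmod (ell2_nth x n))\<^sup>2))"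
    by (intro tendsto_intros summable_LIMSEQ summable_ell2)
  then have "(\<lambda>N. norm (ell2_trunc N (ell2_nth x) - x)) \<longlonglongrightarrow> 0"
    by (simp add: eq)
  then show ?thesis by (simp add: LIM_zero_iff tendsto_norm_zero_iff)
qed

lemma bounded_operator_trunc:
  assumes "bounded_operator A"
  shows "A (ell2_trunc N c) = (\<Sum>n<N. c n *\<^sub>C A (ell2_unit n))"
proof -
  interpret bounded_linear A using assms by (simp add: bounded_operator_def)
  show ?thesis using assms by (simp add: ell2_trunc_def sum bounded_operator_def)
qed

section \<open>Bounded operators given by their coordinates, and adjoints\<close>

text \<open>The uniform bound on finite sections yields both square-summability of
  \<open>T f\<close> and the operator bound. Both the adjoint and the factor \<open>S\<close> are
  constructed this way.\<close>

lemma bounded_operatorI: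
  fixes T :: "ell2 \<Rightarrow> nat \<Rightarrow> complex"
  assumes "\<And>f g i. T (f + g) i = T f i + T g i"
    and "\<And>c f i. T (c *\<^sub>C f) i = c * T f i"
    and "\<And>f N. L2_set (\<lambda>i. cmod (T f i)) {..<N} \<le> K * norm f"
  obtains A where "bounded_operator A" "\<And>f i. ell2_nth (A f) i = T f i"
proof
  define A where "A = (\<lambda>f. Abs_ell2 (T f))"
  show A: "ell2_nth (A f) i = T f i" for f i
    unfolding A_def by (simp add: ell2_nth_Abs[OF L2_bound_summable(1)[OF assms(3)]])
  have C: "A (c *\<^sub>C f) = c *\<^sub>C A f" for c f
    by (rule ell2_eqI) (simp add: A assms scaleC_ell2_nth)
  have "bounded_linear A"
  proof (rule bounded_linear_intro[where K = K])
    show "A (f + g) = A f + A g" for f g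
      by (rule ell2_eqI) (simp add: A assms ell2_nth_simps)
    show "A (r *\<^sub>R f) = r *\<^sub>R A f" for r f
      using C[of "complex_of_real r" f] by (simp add: scaleC_of_real)
    show "norm (A f) \<le> norm f * K" for f
      by (rule norm_ell2_leI) (use assms(3) in \<open>simp add: A mult.commute\<close>)
  qed
  then show "bounded_operator A" using C by (simp add: bounded_operator_def)
qed

text \<open>Testing against unit vectors forces the adjoint to send \<open>y\<close> to the sequence
  \<open>cinner y (A (ell2_unit n))\<close>. A duality argument bounds this sequence. The adjoint
  identity then holds on truncations by linearity, and everywhere by continuity.\<close>

lemma ell2_adjoint_exists:
  assumes "bounded_operator A"
  obtains B where "bounded_operator B" "\<And>x y. cinner (A x) (y::ell2) = cinner x (B y)"
proof -
  interpret A: bounded_linear A using assms by (simp add: bounded_operator_def)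
  obtain K where K: "\<And>x. norm (A x) \<le> norm x * K" using A.bounded by blast
  define T where "T = (\<lambda>y n. cinner y (A (ell2_unit n)))"
  have L2: "L2_set (\<lambda>n. cmod (T y n)) {..<N} \<le> K * norm y" for y N
  proof -
    \<comment> \<open>Truncating \<open>T y\<close> itself is the extremal choice:
      \<open>cinner y (A v)\<close> becomes \<open>L^2\<close>, while \<open>norm v\<close> is only
      \<open>L\<close>, so one factor \<open>L\<close> cancels.\<close>
    define v L where "v = ell2_trunc N (T y)" and "L = L2_set (\<lambda>n. cmod (T y n)) {..<N}"
    have L: "norm v = L" "0 \<le> L" by (simp_all add: v_def L_def norm_ell2_trunc L2_set_nonneg)
    have cs: "cinner y (\<Sum>n<N. c n *\<^sub>C A (ell2_unit n)) = (\<Sum>n<N. cnj (c n) * T y n)" for c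
      by (induction N) (simp_all add: cinner_zero_right cinner_add_right cinner_scaleC_right T_def)
    have "cinner y (A v) = (\<Sum>n<N. cnj (T y n) * T y n)"
      unfolding v_def bounded_operator_trunc[OF assms] by (rule cs)
    also have "\<dots> = complex_of_real (L\<^sup>2)"
      unfolding L_def L2_set_power2 of_real_sum complex_norm_square by (simp add: mult.commute)
    finally have "L\<^sup>2 \<le> norm y * norm (A v)"
      using cmod_cinner_ell2_le[of y "A v"] by (simp add: norm_power)
    also have "\<dots> \<le> norm y * (L * K)"
      using K[of v] L by (intro mult_left_mono) auto
    finally have *: "L * L \<le> K * norm y * L" by (simp add: power2_eq_square mult_ac)
    \<comment> \<open>The bound \<open>K\<close> comes without a sign; nonnegativity settles the
      case \<open>L = 0\<close>, where no cancellation is possible.\<close>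
    have "0 \<le> K"
    proof -
      have "norm (ell2_unit 0) = 1"
        using suminf_finite[of "{0}" "\<lambda>n. (cmod (ell2_nth (ell2_unit 0) n))\<^sup>2"]
        by (simp add: norm_ell2_def ell2_nth_unit)
      then have "norm (A (ell2_unit 0)) \<le> K" using K[of "ell2_unit 0"] by simp
      then show ?thesis by (rule order_trans[OF norm_ge_zero])
    qed
    then show ?thesis
      using * L unfolding L_def[symmetric]
      by (cases "L = 0") (auto simp: mult_le_cancel_right)
  qed
  obtain B where B: "bounded_operator B" "\<And>y n. ell2_nth (B y) n = T y n"
    by (rule bounded_operatorI[of T K])
       (use L2 in \<open>simp_all add: T_def cinner_add_left cinner_scaleC_left\<close>)
  have "cinner (A x) y = cinner x (B y)" for x y
  proof (rule LIMSEQ_unique)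
    have cs: "cinner (\<Sum>n<N. c n *\<^sub>C A (ell2_unit n)) y = (\<Sum>n<N. c n * cnj (T y n))" for c N
    proof (induction N)
      case 0
      show ?case by (simp, metis cinner_commute cinner_zero_right complex_cnj_zero)
    next
      case (Suc N)
      then show ?case
        by (simp add: cinner_add_left cinner_scaleC_left T_def)
           (metis cinner_commute)
    qed
    have "(\<lambda>N. \<Sum>n<N. ell2_nth x n * cnj (ell2_nth (B y) n)) \<longlonglongrightarrow> cinner x (B y)"
      unfolding cinner_ell2_def by (intro summable_LIMSEQ summable_cinner_ell2)
    then show "(\<lambda>N. cinner (A (ell2_trunc N (ell2_nth x))) y) \<longlonglongrightarrow> cinner x (B y)"
      by (simp add: bounded_operator_trunc[OF assms] cs B)
    have "(\<lambda>N. norm (A (ell2_trunc N (ell2_nth x)) - A x) * norm y) \<longlonglongrightarrow> 0"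
      by (intro tendsto_mult_left_zero tendsto_norm_zero LIM_zero A.tendsto ell2_trunc_tendsto)
    then have "(\<lambda>N. cinner (A (ell2_trunc N (ell2_nth x))) y - cinner (A x) y) \<longlonglongrightarrow> 0"
      by (rule Lim_null_comparison[rotated])
         (auto simp: cinner_diff_left[symmetric] cmod_cinner_ell2_le)
    then show "(\<lambda>N. cinner (A (ell2_trunc N (ell2_nth x))) y) \<longlonglongrightarrow> cinner (A x) y"
      by (rule LIM_zero_cancel)
  qed
  with B(1) show ?thesis by (rule that)
qed

text \<open>The last hypothesis says \<open>A = A\<^sup>* S\<close>.\<close>

lemma supraposinormal_if_factor:
  fixes A S :: "ell2 \<Rightarrow> ell2"
  assumes A: "bounded_operator A" and S: "bounded_operator S"
    and AS: "\<And>x y. cinner (A x) y = cinner (S x) (A y)"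
  shows "supraposinormal A"
proof -
  obtain S' where S': "bounded_operator S'" "\<And>x y. cinner (S x) y = cinner x (S' y)"
    using ell2_adjoint_exists[OF S] by metis
  have adj: "cadjoint A = S' \<circ> A"
    by (rule cadjoint_eqI) (simp add: AS S')
  \<comment> \<open>By \<open>adj\<close> this is the factorization \<open>A = A' S\<close> with
    \<open>A'\<close> the adjoint. Evaluated at \<open>S' (A x)\<close> it gives the required
    operator identity with \<open>P = S S'\<close> and \<open>Q = id\<close>.\<close>
  have fac: "S' (A (S x)) = A x" for x
  proof (rule cinner_eqI)
    fix y
    have "cinner (S' (A (S x))) y = cnj (cinner (A y) (S x))"
      by (metis AS S'(2) cinner_commute)
    then show "cinner (S' (A (S x))) y = cinner (A x) y"
      by (metis AS cinner_commute)
  qed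
  have "bounded_operator (S \<circ> S')"
    using S S'(1) unfolding bounded_operator_def o_def
    by (auto intro: bounded_linear_compose)
  moreover have "cinner ((S \<circ> S') x) x = complex_of_real ((norm (S' x))\<^sup>2)" for x
    by (simp add: S'(2) cinner_norm)
  ultimately have "positive_operator (S \<circ> S')"
    unfolding positive_operator_def by simp
  moreover have "positive_operator (id :: ell2 \<Rightarrow> ell2)"
    by (simp add: positive_operator_def bounded_operator_def cinner_norm id_def bounded_linear_ident)
  moreover have "A \<circ> id \<circ> cadjoint A = cadjoint A \<circ> (S \<circ> S') \<circ> A"
    by (simp add: adj fun_eq_iff fac)
  moreover have "dense_range (id :: ell2 \<Rightarrow> ell2)"
    by (simp add: dense_range_def)
  ultimately show ?thesis using A unfolding supraposinormal_def by blast
qed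

lemma L2_set_shift_le:
  "L2_set (\<lambda>i. cmod (ell2_nth f (i + r))) {..<N} \<le> norm f"
proof -
  have "(\<Sum>i<N. (cmod (ell2_nth f (i + r)))\<^sup>2) = (\<Sum>i\<in>(\<lambda>i. i + r) ` {..<N}. (cmod (ell2_nth f i))\<^sup>2)"
    by (subst sum.reindex) (auto simp: inj_on_def)
  also have "\<dots> \<le> (\<Sum>i<N + r. (cmod (ell2_nth f i))\<^sup>2)"
    by (rule sum_mono2) auto
  finally have "L2_set (\<lambda>i. cmod (ell2_nth f (i + r))) {..<N}
      \<le> L2_set (\<lambda>i. cmod (ell2_nth f i)) {..<N + r}"
    unfolding L2_set_def by (rule real_sqrt_le_mono)
  then show ?thesis using L2_set_le_norm_ell2 order_trans by blast
qed

section \<open>The Cesaro matrix of order three\<close>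

definition cesaro3_weight :: "real \<Rightarrow> nat \<Rightarrow> real" where
  "cesaro3_weight \<alpha> i = 1 / ((real i + 1 + \<alpha>) * (real i + 2 + \<alpha>) * (real i + 3 + \<alpha>))"

lemma cesaro3_weight_pos: "\<alpha> > -1 \<Longrightarrow> 0 < cesaro3_weight \<alpha> i"
  by (simp add: cesaro3_weight_def)

lemma cesaro3_weight_antimono:
  assumes "\<alpha> > -1" "i \<le> k"
  shows "cesaro3_weight \<alpha> k \<le> cesaro3_weight \<alpha> i"
  unfolding cesaro3_weight_def using assms
  by (intro divide_left_mono mult_mono mult_pos_pos) auto

text \<open>The quadratic factor vanishes on the two superdiagonals, so the formula extends to them.\<close>

lemma cesaro3_eq:
  assumes "j \<le> i + 2"
  shows "cesaro3 \<alpha> i j = complex_of_real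
    (3 * (real i + 1 - real j) * (real i + 2 - real j) * cesaro3_weight \<alpha> i)"
proof (cases "j \<le> i")
  case False
  then have "j = i + 1 \<or> j = i + 2" using assms by linarith
  with False show ?thesis by (auto simp: cesaro3_def)
qed (simp add: cesaro3_def cesaro3_weight_def)

section \<open>Preimages of the unit vectors\<close>

text \<open>Since \<open>(1 - U)^-3\<close> has entries \<open>(p + 1) * (p + 2) / 2\<close> at
  \<open>p = i - j\<close>, the matrix is \<open>D (1 - U)^-3\<close> with \<open>D\<close> diagonal
  with entries \<open>6 * cesaro3_weight\<close>. Hence the preimage of unit vector \<open>j\<close>
  is \<open>(1 - U)^3\<close> applied to it, divided by the diagonal entry.\<close>

definition cesaro3_preimage :: "real \<Rightarrow> nat \<Rightarrow> ell2" where
  "cesaro3_preimage \<alpha> j = (1 / (6 * cesaro3_weight \<alpha> j)) *\<^sub>R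
    (ell2_unit j - 3 *\<^sub>R ell2_unit (j + 1) + 3 *\<^sub>R ell2_unit (j + 2) - ell2_unit (j + 3))"

lemma cinner_cesaro3_preimage:
  "cinner x (cesaro3_preimage \<alpha> j) =
    (ell2_nth x j - 3 * ell2_nth x (j + 1) + 3 * ell2_nth x (j + 2) - ell2_nth x (j + 3))
      / complex_of_real (6 * cesaro3_weight \<alpha> j)"
  by (simp add: cesaro3_preimage_def cinner_scaleR_right cinner_add_right cinner_diff_right
      cinner_unit_right)

lemma cesaro3_preimage:
  assumes "\<alpha> > -1" "bounded_operator M" "has_matrix M (cesaro3 \<alpha>)"
  shows "M (cesaro3_preimage \<alpha> j) = ell2_unit j"
proof (rule ell2_eqI)
  fix i
  interpret bounded_linear M using assms by (simp add: bounded_operator_def)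
  have w: "cesaro3_weight \<alpha> j \<noteq> 0" using cesaro3_weight_pos[OF assms(1), of j] by simp
  have "ell2_nth (M (cesaro3_preimage \<alpha> j)) i
      = (cesaro3 \<alpha> i j - 3 * cesaro3 \<alpha> i (j + 1) + 3 * cesaro3 \<alpha> i (j + 2) - cesaro3 \<alpha> i (j + 3))
        / complex_of_real (6 * cesaro3_weight \<alpha> j)"
    by (simp add: cesaro3_preimage_def scaleR add diff ell2_nth_simps
        has_matrix_column[OF assms(3)])
  also have "\<dots> = ell2_nth (ell2_unit j) i"
  proof -
    consider "i < j" | "i = j" | "i \<ge> j + 1" by linarith
    then show ?thesis
    proof cases
      case 1
      then show ?thesis by (simp add: cesaro3_def ell2_nth_unit)
    next
      case 2
      then show ?thesis using w by (simp add: cesaro3_eq ell2_nth_unit) (simp add: cesaro3_def)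
    next
      \<comment> \<open>Here \<open>j + 3 \<le> i + 2\<close>, so the extended formula covers all
        four columns, and a third difference of a quadratic polynomial vanishes.\<close>
      case 3
      then have "cesaro3 \<alpha> i j - 3 * cesaro3 \<alpha> i (j + 1) + 3 * cesaro3 \<alpha> i (j + 2) - cesaro3 \<alpha> i (j + 3) = 0"
        by (simp add: cesaro3_eq) (simp add: algebra_simps)
      with 3 show ?thesis by (simp add: ell2_nth_unit)
    qed
  qed
  finally show "ell2_nth (M (cesaro3_preimage \<alpha> j)) i = ell2_nth (ell2_unit j) i" .
qed

lemma tendsto_zero_diff_zero:
  fixes z :: "nat \<Rightarrow> complex"
  assumes "z \<longlonglongrightarrow> 0" "\<And>n. z n - z (Suc n) = 0"
  shows "z n = 0"
proof -
  have "z n = z 0" for n by (induction n) (use assms(2) in auto)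
  then have "z = (\<lambda>_. z 0)" by auto
  then have "z 0 = 0" using assms(1) by (metis tendsto_const LIMSEQ_unique)
  then show ?thesis using \<open>z n = z 0\<close> by simp
qed

text \<open>Orthogonality to all preimages says that the third differences of \<open>z\<close>
  vanish. They are undone one order at a time, from \<open>c\<close> to \<open>b\<close> to
  \<open>a\<close>, each being a null sequence.\<close>

lemma cesaro3_preimage_total:
  assumes "\<alpha> > -1" "\<And>j. cinner z (cesaro3_preimage \<alpha> j) = 0"
  shows "z = 0"
proof -
  define a b c where "a = ell2_nth z" and "b = (\<lambda>n. a n - a (Suc n))" and "c = (\<lambda>n. b n - b (Suc n))"
  have "(\<lambda>n. (cmod (a n))\<^sup>2) \<longlonglongrightarrow> 0"
    unfolding a_def by (rule summable_LIMSEQ_zero[OF summable_ell2])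
  then have a: "a \<longlonglongrightarrow> 0"
    using tendsto_real_sqrt by (fastforce simp: tendsto_norm_zero_iff)
  have b: "b \<longlonglongrightarrow> 0"
    unfolding b_def using tendsto_diff[OF a LIMSEQ_Suc[OF a]] by simp
  have c: "c \<longlonglongrightarrow> 0"
    unfolding c_def using tendsto_diff[OF b LIMSEQ_Suc[OF b]] by simp
  have "c n - c (Suc n) = 0" for n
    using assms(2)[of n] cesaro3_weight_pos[OF assms(1), of n]
    unfolding cinner_cesaro3_preimage
    by (simp add: c_def b_def a_def algebra_simps numeral_eq_Suc)
  then have "c n = 0" for n using tendsto_zero_diff_zero[OF c] by blast
  then have "b n = 0" for n using tendsto_zero_diff_zero[OF b] c_def by metis
  then have "a n = 0" for n using tendsto_zero_diff_zero[OF a] b_def by metis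
  then show ?thesis by (intro ell2_eqI) (simp add: a_def zero_ell2_nth)
qed

section \<open>The matrix of the factor \<open>S\<close> and bounds for its entries\<close>

text \<open>The matrix entries of \<open>S\<close>: a weighted third difference down column
  \<open>k\<close> of the Cesaro matrix. They vanish for \<open>k > j + 3\<close>.\<close>

definition cesaro3_factor :: "real \<Rightarrow> nat \<Rightarrow> nat \<Rightarrow> complex" where
  "cesaro3_factor \<alpha> j k =
    (cesaro3 \<alpha> j k - 3 * cesaro3 \<alpha> (j + 1) k + 3 * cesaro3 \<alpha> (j + 2) k - cesaro3 \<alpha> (j + 3) k)
      / complex_of_real (6 * cesaro3_weight \<alpha> j)"

text \<open>With \<open>t = j + 1 + \<alpha>\<close> and \<open>p = j - k\<close>: in the numerator all terms of degree three or more
  cancel, which is why the entries decay.\<close>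

lemma third_difference_identity:
  fixes p t :: real
  assumes "t > 0"
  shows "(3 * (p + 1) * (p + 2) * (1 / (t * (t + 1) * (t + 2)))
      - 3 * (3 * (p + 2) * (p + 3) * (1 / ((t + 1) * (t + 2) * (t + 3))))
      + 3 * (3 * (p + 3) * (p + 4) * (1 / ((t + 2) * (t + 3) * (t + 4))))
      - 3 * (p + 4) * (p + 5) * (1 / ((t + 3) * (t + 4) * (t + 5))))
        / (6 * (1 / (t * (t + 1) * (t + 2))))
    = (60 * p\<^sup>2 + p * (180 - 72 * t) + 18 * t\<^sup>2 - 126 * t + 120)
        / (2 * ((t + 3) * (t + 4) * (t + 5)))"
proof -
  have nz: "t \<noteq> 0" "t + 1 \<noteq> 0" "t + 2 \<noteq> 0" "t + 3 \<noteq> 0" "t + 4 \<noteq> 0" "t + 5 \<noteq> 0"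
    using assms by auto
  show ?thesis
    using nz by (simp add: divide_simps) algebra
qed

text \<open>With \<open>u = t / c\<close>, each of \<open>p\<close>, \<open>t\<close> and
  \<open>n\<close> is at most \<open>u\<close>. The numerator is therefore of order
  \<open>u^2\<close>, while the denominator is at least \<open>2 * c^3 * u^3\<close>.\<close>

lemma third_difference_bound:
  fixes p t n c :: real
  assumes c: "0 < c" "c \<le> 1" and t: "c * n \<le> t" and p: "0 \<le> p" "p \<le> n" and n: "1 \<le> n"
  shows "\<bar>(60 * p\<^sup>2 + p * (180 - 72 * t) + 18 * t\<^sup>2 - 126 * t + 120)
        / (2 * ((t + 3) * (t + 4) * (t + 5)))\<bar> \<le> 300 / c ^ 3 / n"
proof -
  define u where "u = t / c"
  have nu: "n \<le> u" using t c by (simp add: u_def pos_le_divide_eq mult.commute)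
  have tu: "t = c * u" using c by (simp add: u_def)
  have "0 < c * n" using c n by simp
  then have t0: "0 < t" using t by linarith
  have t_le: "t \<le> u" unfolding tu using c nu n by (simp add: mult_left_le_one_le)
  have sq: "p\<^sup>2 \<le> u\<^sup>2" "t\<^sup>2 \<le> u\<^sup>2" "p * t \<le> u\<^sup>2" "p \<le> u\<^sup>2" "t \<le> u\<^sup>2" "1 \<le> u\<^sup>2" "0 \<le> p * t" "0 \<le> p\<^sup>2" "0 \<le> t\<^sup>2"
  proof -
    have "1 \<le> u" using nu n by simp
    then have uu: "u \<le> u\<^sup>2" by (simp add: power2_eq_square)
    show "p\<^sup>2 \<le> u\<^sup>2" "t\<^sup>2 \<le> u\<^sup>2" using p nu t0 t_le by (auto intro: power_mono)
    show "p * t \<le> u\<^sup>2" unfolding power2_eq_square using p nu t0 t_le by (intro mult_mono) auto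
    show "p \<le> u\<^sup>2" "t \<le> u\<^sup>2" "1 \<le> u\<^sup>2" using uu p nu t_le \<open>1 \<le> u\<close> by linarith+
    show "0 \<le> p * t" "0 \<le> p\<^sup>2" "0 \<le> t\<^sup>2" using p t0 by auto
  qed
  \<comment> \<open>The absolute values of the coefficients add up to 576, rounded up to
    600.\<close>
  have "\<bar>60 * p\<^sup>2 + p * (180 - 72 * t) + 18 * t\<^sup>2 - 126 * t + 120\<bar> \<le> 600 * u\<^sup>2"
  proof -
    have "p * (180 - 72 * t) = 180 * p - 72 * (p * t)" by algebra
    then show ?thesis using sq p t0 unfolding abs_le_iff by linarith
  qed
  moreover have "2 * (t ^ 3) \<le> 2 * ((t + 3) * (t + 4) * (t + 5))"
    unfolding power3_eq_cube using t0 by (intro mult_left_mono mult_mono) auto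
  ultimately have "\<bar>60 * p\<^sup>2 + p * (180 - 72 * t) + 18 * t\<^sup>2 - 126 * t + 120\<bar>
        / (2 * ((t + 3) * (t + 4) * (t + 5))) \<le> 600 * u\<^sup>2 / (2 * t ^ 3)"
    using t0 by (intro frac_le) auto
  also have "\<dots> = 300 / c ^ 3 / u"
    using c nu n unfolding tu by (simp add: field_simps power2_eq_square power3_eq_cube)
  also have "\<dots> \<le> 300 / c ^ 3 / n"
    using c nu n by (intro divide_left_mono) auto
  finally show ?thesis using t0 by (simp add: abs_divide abs_mult)
qed

lemma cmod_cesaro3_factor_lower:
  assumes "\<alpha> > -1" "k \<le> j"
  shows "cmod (cesaro3_factor \<alpha> j k) \<le> 300 / (min 1 (1 + \<alpha>)) ^ 3 / (real j + 1)"
proof -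
  \<comment> \<open>The constant \<open>c\<close> keeps \<open>t\<close> comparable to
    \<open>j + 1\<close> for negative \<alpha> as well; the resulting bound degenerates as \<alpha>
    tends to -1.\<close>
  define c t p where "c = min 1 (1 + \<alpha>)" and "t = real j + 1 + \<alpha>" and "p = real j - real k"
  have c: "0 < c" "c \<le> 1" using assms by (auto simp: c_def)
  have t: "0 < t" using assms by (simp add: t_def)
  have ct: "c * (real j + 1) \<le> t"
  proof -
    have "c * real j \<le> 1 * real j" using c by (intro mult_right_mono) auto
    moreover have "c \<le> 1 + \<alpha>" by (simp add: c_def)
    ultimately show ?thesis by (simp add: algebra_simps t_def)
  qed
  have w: "cesaro3_weight \<alpha> j = 1 / (t * (t + 1) * (t + 2))"
    "cesaro3_weight \<alpha> (j + 1) = 1 / ((t + 1) * (t + 2) * (t + 3))"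
    "cesaro3_weight \<alpha> (j + 2) = 1 / ((t + 2) * (t + 3) * (t + 4))"
    "cesaro3_weight \<alpha> (j + 3) = 1 / ((t + 3) * (t + 4) * (t + 5))"
    by (simp_all add: cesaro3_weight_def t_def add_ac)
  have m: "cesaro3 \<alpha> j k = complex_of_real (3 * (p + 1) * (p + 2) * cesaro3_weight \<alpha> j)"
    "cesaro3 \<alpha> (j + 1) k = complex_of_real (3 * (p + 2) * (p + 3) * cesaro3_weight \<alpha> (j + 1))"
    "cesaro3 \<alpha> (j + 2) k = complex_of_real (3 * (p + 3) * (p + 4) * cesaro3_weight \<alpha> (j + 2))"
    "cesaro3 \<alpha> (j + 3) k = complex_of_real (3 * (p + 4) * (p + 5) * cesaro3_weight \<alpha> (j + 3))"
    using assms(2) by (simp_all add: cesaro3_eq p_def algebra_simps)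
  have "cesaro3_factor \<alpha> j k = complex_of_real
     ((60 * p\<^sup>2 + p * (180 - 72 * t) + 18 * t\<^sup>2 - 126 * t + 120) / (2 * ((t + 3) * (t + 4) * (t + 5))))"
    unfolding third_difference_identity[OF t, symmetric] cesaro3_factor_def m w by simp
  then show ?thesis
    unfolding c_def[symmetric]
    by (simp only: norm_of_real) (rule third_difference_bound[OF c ct], use assms(2) in \<open>simp_all add: p_def\<close>)
qed

text \<open>A bound without decay suffices above the diagonal: only three superdiagonals are
  nonzero, and each acts as a weighted backward shift.\<close>

lemma cmod_cesaro3_factor_upper:
  assumes "\<alpha> > -1" "j < k"
  shows "cmod (cesaro3_factor \<alpha> j k) \<le> 48"
proof -
  have w: "0 < cesaro3_weight \<alpha> j" by (rule cesaro3_weight_pos[OF assms(1)])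
  \<comment> \<open>As \<open>k \<ge> j + 1\<close> and \<open>r \<le> 3\<close>, the two linear
    factors are at most 3 and 4, whence \<open>36 = 3 * 3 * 4\<close>; the weights decrease along
    the rows.\<close>
  have m: "cmod (cesaro3 \<alpha> (j + r) k) \<le> 36 * cesaro3_weight \<alpha> j" if "r \<le> 3" for r
  proof (cases "k \<le> j + r")
    case True
    have "cmod (cesaro3 \<alpha> (j + r) k) = 3 * (real (j + r) + 1 - real k) * (real (j + r) + 2 - real k)
        * cesaro3_weight \<alpha> (j + r)"
      unfolding cesaro3_eq[OF trans_le_add1[OF True]] norm_of_real
      using True cesaro3_weight_pos[OF assms(1), of "j + r"] by (intro abs_of_nonneg) auto
    also have "\<dots> \<le> 3 * 3 * 4 * cesaro3_weight \<alpha> j"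
      using True that assms cesaro3_weight_pos[OF assms(1), of "j + r"]
      by (intro mult_mono cesaro3_weight_antimono) auto
    finally show ?thesis by simp
  qed (use w in \<open>simp add: cesaro3_def\<close>)
  have "cmod (cesaro3 \<alpha> j k - 3 * cesaro3 \<alpha> (j + 1) k + 3 * cesaro3 \<alpha> (j + 2) k - cesaro3 \<alpha> (j + 3) k)
      \<le> cmod (cesaro3 \<alpha> j k) + 3 * cmod (cesaro3 \<alpha> (j + 1) k) + 3 * cmod (cesaro3 \<alpha> (j + 2) k)
        + cmod (cesaro3 \<alpha> (j + 3) k)"
    by (intro order_trans[OF norm_triangle_ineq4] order_trans[OF norm_triangle_ineq] add_mono)
       (simp_all add: norm_mult)
  \<comment> \<open>The coefficients 1, 3, 3, 1 sum to 8, and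
    \<open>8 * 36 = 48 * 6\<close>.\<close>
  also have "\<dots> \<le> 48 * (6 * cesaro3_weight \<alpha> j)"
    using m[of 0] m[of 1] m[of 2] m[of 3] by simp
  finally show ?thesis
    unfolding cesaro3_factor_def norm_divide norm_of_real using w by (simp add: pos_divide_le_eq)
qed

section \<open>Boundedness of the factor \<open>S\<close>\<close>

lemma cinner_preimage_eq_sum:
  assumes "has_matrix M (cesaro3 \<alpha>)"
  shows "cinner (M f) (cesaro3_preimage \<alpha> j) = (\<Sum>k\<le>j + 3. cesaro3_factor \<alpha> j k * ell2_nth f k)"
proof -
  \<comment> \<open>All four rows are summed over the common range up to \<open>j + 3\<close>, with
    zeros beyond the diagonal, so that the sums can be combined termwise.\<close>
  have M: "ell2_nth (M f) (j + r) = (\<Sum>k\<le>j + 3. cesaro3 \<alpha> (j + r) k * ell2_nth f k)" if "r \<le> 3" for r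
  proof (rule sums_unique2)
    show "(\<lambda>k. cesaro3 \<alpha> (j + r) k * ell2_nth f k) sums ell2_nth (M f) (j + r)"
      using assms by (simp add: has_matrix_def)
    show "(\<lambda>k. cesaro3 \<alpha> (j + r) k * ell2_nth f k)
        sums (\<Sum>k\<le>j + 3. cesaro3 \<alpha> (j + r) k * ell2_nth f k)"
      by (rule sums_finite) (use that in \<open>auto simp: cesaro3_def\<close>)
  qed
  have M0: "ell2_nth (M f) j = (\<Sum>k\<le>j + 3. cesaro3 \<alpha> j k * ell2_nth f k)"
    using M[of 0] by simp
  have "cinner (M f) (cesaro3_preimage \<alpha> j) = (\<Sum>k\<le>j + 3.
      (cesaro3 \<alpha> j k * ell2_nth f k - 3 * (cesaro3 \<alpha> (j + 1) k * ell2_nth f k)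
      + 3 * (cesaro3 \<alpha> (j + 2) k * ell2_nth f k) - cesaro3 \<alpha> (j + 3) k * ell2_nth f k)
        / complex_of_real (6 * cesaro3_weight \<alpha> j))"
    unfolding cinner_cesaro3_preimage M0
    by (subst (1 2 3) M, simp, simp, simp)
       (simp only: sum_distrib_left sum.distrib[symmetric] sum_subtractf[symmetric] sum_divide_distrib)
  also have "\<dots> = (\<Sum>k\<le>j + 3. cesaro3_factor \<alpha> j k * ell2_nth f k)"
    by (rule sum.cong) (simp_all add: cesaro3_factor_def algebra_simps)
  finally show ?thesis .
qed

text \<open>The part on and below the diagonal is dominated by averages, costing the factor 2 of
  Hardy's inequality. The three superdiagonals contribute \<open>48 * norm f\<close> each, hence
  144.\<close>

lemma cesaro3_factor_L2_bound:
  assumes "\<alpha> > -1" "has_matrix M (cesaro3 \<alpha>)"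
  shows "L2_set (\<lambda>j. cmod (cinner (M f) (cesaro3_preimage \<alpha> j))) {..<N}
    \<le> (2 * (300 / (min 1 (1 + \<alpha>)) ^ 3) + 144) * norm f"
proof -
  define K where "K = 300 / (min 1 (1 + \<alpha>)) ^ 3"
  have K: "0 \<le> K" using assms(1) by (simp add: K_def)
  define F where "F = (\<lambda>n. cmod (ell2_nth f n))"
  define H where "H = (\<lambda>j. (\<Sum>k\<le>j. F k) / (real j + 1))"
  have pt: "cmod (cinner (M f) (cesaro3_preimage \<alpha> j))
      \<le> K * H j + 48 * F (j + 1) + 48 * F (j + 2) + 48 * F (j + 3)" for j
  proof -
    have "cmod (cinner (M f) (cesaro3_preimage \<alpha> j)) \<le> (\<Sum>k\<le>j + 3. cmod (cesaro3_factor \<alpha> j k) * F k)"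
      unfolding cinner_preimage_eq_sum[OF assms(2)] F_def norm_mult[symmetric] by (rule norm_sum)
    also have "\<dots> = (\<Sum>k\<le>j. cmod (cesaro3_factor \<alpha> j k) * F k) + cmod (cesaro3_factor \<alpha> j (j + 1)) * F (j + 1)
        + cmod (cesaro3_factor \<alpha> j (j + 2)) * F (j + 2) + cmod (cesaro3_factor \<alpha> j (j + 3)) * F (j + 3)"
      by (simp add: numeral_eq_Suc)
    also have "\<dots> \<le> (\<Sum>k\<le>j. K / (real j + 1) * F k) + 48 * F (j + 1) + 48 * F (j + 2) + 48 * F (j + 3)"
      unfolding K_def
      by (intro add_mono sum_mono mult_right_mono cmod_cesaro3_factor_lower cmod_cesaro3_factor_upper assms)
         (auto simp: F_def)
    also have "(\<Sum>k\<le>j. K / (real j + 1) * F k) = K * H j"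
      by (simp add: H_def sum_distrib_left sum_divide_distrib)
    finally show ?thesis .
  qed
  have "L2_set (\<lambda>j. cmod (cinner (M f) (cesaro3_preimage \<alpha> j))) {..<N}
      \<le> L2_set (\<lambda>j. K * H j + 48 * F (j + 1) + 48 * F (j + 2) + 48 * F (j + 3)) {..<N}"
    by (rule L2_set_mono) (use pt in simp_all)
  also have "\<dots> \<le> L2_set (\<lambda>j. K * H j) {..<N} + L2_set (\<lambda>j. 48 * F (j + 1)) {..<N}
      + L2_set (\<lambda>j. 48 * F (j + 2)) {..<N} + L2_set (\<lambda>j. 48 * F (j + 3)) {..<N}"
    by (intro order_trans[OF L2_set_triangle_ineq] add_mono order_refl)
  also have "\<dots> = K * L2_set H {..<N} + 48 * L2_set (\<lambda>j. F (j + 1)) {..<N}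
      + 48 * L2_set (\<lambda>j. F (j + 2)) {..<N} + 48 * L2_set (\<lambda>j. F (j + 3)) {..<N}"
    using K by (simp add: L2_set_right_distrib)
  also have "\<dots> \<le> K * (2 * norm f) + 48 * norm f + 48 * norm f + 48 * norm f"
  proof (intro add_mono mult_left_mono)
    have "L2_set H {..<N} \<le> 2 * L2_set F {..<N}"
      unfolding H_def by (rule hardy_L2_set) (simp add: F_def)
    also have "L2_set F {..<N} \<le> norm f" unfolding F_def by (rule L2_set_le_norm_ell2)
    finally show "L2_set H {..<N} \<le> 2 * norm f" by simp
  qed (use K in \<open>auto simp: F_def simp del: One_nat_def add_2_eq_Suc' add_Suc_right intro: L2_set_shift_le\<close>)
  finally show ?thesis by (simp add: K_def algebra_simps)
qed

theorem theorem2p1: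
  fixes \<alpha> :: real and M :: "ell2 \<Rightarrow> ell2"
  assumes "\<alpha> > -1"
    and "bounded_operator M"
    and "has_matrix M (cesaro3 \<alpha>)"
  shows "supraposinormal M"
proof -
  have lin: "M (f + g) = M f + M g" "M (c *\<^sub>C f) = c *\<^sub>C M f" for f g c
    using assms(2) by (auto simp: bounded_operator_def linear_simps)
  obtain S where S: "bounded_operator S"
    and S_nth: "\<And>f j. ell2_nth (S f) j = cinner (M f) (cesaro3_preimage \<alpha> j)"
    by (rule bounded_operatorI[OF _ _ cesaro3_factor_L2_bound[OF assms(1,3)]])
       (auto simp: lin cinner_add_left cinner_scaleC_left)
  obtain M' where M': "\<And>x y. cinner (M x) y = cinner x (M' y)"
    using ell2_adjoint_exists[OF assms(2)] by metis
  have M'_left: "cinner (M' x) y = cinner x (M y)" for x y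
    by (metis M' cinner_commute)
  \<comment> \<open>Against preimage \<open>j\<close>, moving \<open>M'\<close> across turns the
    first term into coordinate \<open>j\<close> of \<open>S x\<close>, which by construction of
    \<open>S\<close> equals the second term. Totality of the preimages finishes the
    argument.\<close>
  have "M' (S x) - M x = 0" for x
  proof (rule cesaro3_preimage_total[OF assms(1)])
    fix j
    show "cinner (M' (S x) - M x) (cesaro3_preimage \<alpha> j) = 0"
      by (simp add: cinner_diff_left M'_left cesaro3_preimage[OF assms] cinner_unit_right S_nth)
  qed
  then have "cinner (M x) y = cinner (S x) (M y)" for x y
    by (metis M'_left right_minus_eq)
  then show ?thesis
    by (rule supraposinormal_if_factor[OF assms(2) S])
qed

end
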